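(* Let $\mathbb{K}$ be the field of real or complex numbers, let $X$ be a topological vector space over $\mathbb{K}$, and let $Y$ be a vector space over a field $\mathbb{F}$ of characteristic zero. Let $n\ge 2$, let $\alpha_1,\ldots,\alpha_n\in\mathbb{K}$ be non-zero, let $\beta_1,\ldots,\beta_n\in\mathbb{F}$ be non-zero, and let $K\subseteq X$ be a non-empty open connected set such that $\sum_{i\le n}\alpha_iK\subseteq K$. (i) Let $f:K\to Y$ be a function such that $$f\Big(\sum_{i\le n}\alpha_ix_i\Big)=\sum_{i\le n}\beta_i f(x_i)\qquad\text{for all }x_1,\ldots,x_n\in K. \quad (\ast)$$ Then there exist a unique group homomorphism $A:X\to Y$ and a unique $b\in Y$ for which $$A(\alpha_ix)=\beta_iA(x)\qquad\text{for all }x\in X\text{ and all } i=1,\ldots,n, \quad (\ast\ast)$$ and $$f(x)=A(x)+b\qquad\text{for all }x\in K, \quad (\ast\ast\ast)$$ where necessarily $b=0$ if $\sum_{i\le n}\beta_i\neq 1$ (and $b\in Y$ can be arbitrary otherwise). (ii) Conversely, if $A:X\to Y$ is a group homomorphism which satisfies $(\ast\ast)$, and $f:K\to Y$ is defined by $(\ast\ast\ast)$ for some $b\in Y$, with $b=0$ if $\sum_{i\le n}\beta_i\neq 1$, then $f$ satisfies $(\ast)$.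
   Context: Here $\sum_{i\le n}\alpha_iK:=\{\sum_{i\le n}\alpha_ix_i: x_1,\ldots,x_n\in K\}$ (with independent choices of the $x_i$). Group homomorphism means homomorphism of the additive groups of $X$ and $Y$. *)

theory Defs
  imports "HOL-Analysis.Analysis"
begin

text \<open>
  Scalars: the field of real or complex numbers. A field of this class is, up to an isometric
  field isomorphism, \<^typ>\<open>real\<close> or \<^typ>\<open>complex\<close>, and both are instances, so that a statement over
  \<open>'k::real_or_complex\<close> covers precisely the two cases.
\<close>

class real_or_complex = real_normed_field +
  assumes real_or_complex:
    "(\<exists>h :: 'a \<Rightarrow> real. bij h \<and> (\<forall>x y. h (x + y) = h x + h y) \<and>
        (\<forall>x y. h (x * y) = h x * h y) \<and> (\<forall>x. norm (h x) = norm x)) \<or>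
     (\<exists>h :: 'a \<Rightarrow> complex. bij h \<and> (\<forall>x y. h (x + y) = h x + h y) \<and>
        (\<forall>x y. h (x * y) = h x * h y) \<and> (\<forall>x. norm (h x) = norm x))"

instance real :: real_or_complex
  by standard (rule disjI1, rule exI[of _ id], simp)

instance complex :: real_or_complex
  by standard (rule disjI2, rule exI[of _ id], simp)

text \<open>
  Continuity of addition is part of the class \<^class>\<open>topological_ab_group_add\<close>. The topology is
  not required to be Hausdorff.
\<close>

locale topological_vector_space = vector_space scaleX
  for scaleX :: "'k::real_or_complex \<Rightarrow> 'x::topological_ab_group_add \<Rightarrow> 'x" +
  assumes continuous_scale: "continuous_on UNIV (\<lambda>(c, x). scaleX c x)"

definition weighted_sumset ::
  "('k \<Rightarrow> 'x::comm_monoid_add \<Rightarrow> 'x) \<Rightarrow> nat \<Rightarrow> (nat \<Rightarrow> 'k) \<Rightarrow> 'x set \<Rightarrow> 'x set" where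
  "weighted_sumset scaleX n \<alpha> K =
     {\<Sum>i=1..n. scaleX (\<alpha> i) (x i) | x. \<forall>i\<in>{1..n}. x i \<in> K}"

text \<open>
  A function \<open>K \<Rightarrow> Y\<close> is represented by a total function of which only the values on \<open>K\<close> matter
  (the left-hand argument below lies in \<open>K\<close> if \<^term>\<open>weighted_sumset scaleX n \<alpha> K \<subseteq> K\<close>).
\<close>

definition linear_functional_eq ::
  "('k \<Rightarrow> 'x::comm_monoid_add \<Rightarrow> 'x) \<Rightarrow> ('f \<Rightarrow> 'y::comm_monoid_add \<Rightarrow> 'y) \<Rightarrow>
   nat \<Rightarrow> (nat \<Rightarrow> 'k) \<Rightarrow> (nat \<Rightarrow> 'f) \<Rightarrow> 'x set \<Rightarrow> ('x \<Rightarrow> 'y) \<Rightarrow> bool" where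
  "linear_functional_eq scaleX scaleY n \<alpha> \<beta> K f \<longleftrightarrow>
     (\<forall>x. (\<forall>i\<in>{1..n}. x i \<in> K) \<longrightarrow>
        f (\<Sum>i=1..n. scaleX (\<alpha> i) (x i)) = (\<Sum>i=1..n. scaleY (\<beta> i) (f (x i))))"

end

theory Submission
  imports Defs
begin

text \<open>
  Fix \<open>x \<in> K\<close> and write \<open>D h = f (x + h) - f x\<close>. Perturbing two of the arguments of the functional
  equation around \<open>x\<close> shows that \<open>f (s + \<alpha>\<^sub>1 h + \<alpha>\<^sub>2 k) - f s = \<beta>\<^sub>1 D h + \<beta>\<^sub>2 D k\<close> with
  \<open>s = \<Sum>\<^sub>i \<alpha>\<^sub>i x\<close>, and the substitution \<open>k \<mapsto> (\<alpha>\<^sub>1 / \<alpha>\<^sub>2) k\<close> makes \<open>D\<close> additive near \<open>0\<close>. By halving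
  arguments, \<open>D\<close> extends from a neighbourhood of \<open>0\<close> to a unique additive map \<open>A\<^sub>x\<close> on \<open>X\<close>.
  Hence \<open>A\<^sub>x\<close> is locally constant in \<open>x\<close>, so constant, say \<open>A\<close>, by connectedness, and then \<open>f - A\<close> is locally constant, so constant.
\<close>

section \<open>Scaling near the origin of a topological vector space\<close>

context topological_vector_space
begin

lemma tendsto_scale:
  assumes "(c \<longlongrightarrow> c0) F" "(x \<longlongrightarrow> x0) F"
  shows "((\<lambda>t. scaleX (c t) (x t)) \<longlongrightarrow> scaleX c0 x0) F"
proof -
  have "((\<lambda>t. (\<lambda>(c, x). scaleX c x) (c t, x t)) \<longlongrightarrow> (\<lambda>(c, x). scaleX c x) (c0, x0)) F"
    using continuous_scale tendsto_Pair[OF assms]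
    by (rule continuous_on_tendsto_compose) auto
  then show ?thesis by simp
qed

lemma tendsto_scale_powers_of_half:
  "(\<lambda>N. scaleX (inverse (2 ^ N)) u) \<longlonglongrightarrow> 0"
proof -
  have "(\<lambda>N. inverse 2 ^ N :: 'k) \<longlonglongrightarrow> 0"
    by (rule LIMSEQ_power_zero) (simp add: norm_inverse)
  from tendsto_scale[OF this tendsto_const[of u]] show ?thesis
    by (simp only: power_inverse scale_zero_left)
qed

text \<open>Every neighbourhood of 0 contains a balanced one. This keeps all the halves of a small
  vector inside a given neighbourhood at once, not merely from some index on.\<close>

lemma eventually_nhds_0_scale_le_1:
  assumes Q: "eventually Q (nhds 0)"
  shows "\<forall>\<^sub>F u in nhds 0. \<forall>c. norm c \<le> 1 \<longrightarrow> Q (scaleX c u)"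
proof -
  have "((\<lambda>p. scaleX (fst p) (snd p)) \<longlongrightarrow> scaleX (fst (0, 0)) (snd (0, 0))) (nhds (0, 0))"
    by (intro tendsto_scale) (simp_all add: nhds_prod filterlim_fst filterlim_snd)
  then have "\<forall>\<^sub>F p in nhds 0 \<times>\<^sub>F nhds 0. Q (scaleX (fst p) (snd p))"
    using Q by (auto simp: filterlim_iff nhds_prod)
  then obtain P R where P: "eventually P (nhds (0 :: 'k))" and R: "eventually R (nhds (0 :: 'x))"
    and PR: "\<And>c u. P c \<Longrightarrow> R u \<Longrightarrow> Q (scaleX c u)"
    by (auto simp: eventually_prod_filter)
  obtain d where d: "d > 0" "\<And>c. norm c < d \<Longrightarrow> P c"
    using P by (auto simp: eventually_nhds_metric dist_norm)
  \<comment> \<open>Joint continuity at (0, 0) only handles scalars of norm below \<open>d\<close>.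
    Writing \<open>c u\<close> as \<open>(c e) (u / e)\<close> shrinks the scalar by
    \<open>e\<close> and leaves the inverse factor to the vector.\<close>
  define e :: 'k where "e = of_real (d / 2)"
  have e: "e \<noteq> 0" "norm e < d"
    using d(1) by (auto simp: e_def)
  have "((\<lambda>u. scaleX (inverse e) u) \<longlongrightarrow> scaleX (inverse e) 0) (nhds 0)"
    by (intro tendsto_scale tendsto_const) (simp add: filterlim_ident)
  then have "\<forall>\<^sub>F u in nhds 0. R (scaleX (inverse e) u)"
    using R by (auto simp: filterlim_iff)
  then show ?thesis
  proof (eventually_elim, intro allI impI)
    fix u and c :: 'k
    assume u: "R (scaleX (inverse e) u)" and c: "norm c \<le> 1"
    have "norm (c * e) < d"
      using c e(2) mult_right_mono[of "norm c" 1 "norm e"] by (simp add: norm_mult)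
    from PR[OF d(2)[OF this] u] show "Q (scaleX c u)"
      using e(1) by (simp add: mult.assoc)
  qed
qed

end

section \<open>Extending and comparing additive maps by halving\<close>

locale tvs_vector_space_pair =
  topological_vector_space scaleX + Y: vector_space scaleY
  for scaleX :: "'k::real_or_complex \<Rightarrow> 'x::topological_ab_group_add \<Rightarrow> 'x"
    and scaleY :: "'f::field_char_0 \<Rightarrow> 'y::ab_group_add \<Rightarrow> 'y"
begin

lemma scaleY_power2_Suc: "scaleY (2 ^ Suc N) y = scaleY (2 ^ N) (y + y)"
proof -
  have "scaleY (2 ^ Suc N) y = scaleY (2 ^ N) (scaleY (1 + 1) y)"
    by (simp add: mult.commute)
  also have "scaleY (1 + 1) y = y + y"
    by (subst Y.scale_left_distrib) simp
  finally show ?thesis .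
qed

lemma scaleX_half_add_half:
  "scaleX (inverse (2 ^ Suc N)) u + scaleX (inverse (2 ^ Suc N)) u = scaleX (inverse (2 ^ N)) u"
  unfolding scale_left_distrib[symmetric] by simp

lemma additive_rescale:
  fixes A :: "'x \<Rightarrow> 'y"
  assumes "Modules.additive A"
  shows "scaleY (2 ^ N) (A (scaleX (inverse (2 ^ N)) u)) = A u"
proof (induction N)
  case (Suc N)
  have "A (scaleX (inverse (2 ^ N)) u) =
      A (scaleX (inverse (2 ^ Suc N)) u) + A (scaleX (inverse (2 ^ Suc N)) u)"
    by (simp only: additive.add[OF assms, symmetric] scaleX_half_add_half)
  with Suc show ?case
    by (simp only: scaleY_power2_Suc)
qed simp

text \<open>Repeated halving moves any \<open>u\<close> into the neighbourhood of agreement, and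
  \<open>additive_rescale\<close> recovers the values at \<open>u\<close> from those at the small
  vector.\<close>

lemma additive_eqI:
  fixes A A' :: "'x \<Rightarrow> 'y"
  assumes A: "Modules.additive A" and A': "Modules.additive A'"
    and eq: "\<forall>\<^sub>F u in nhds 0. A u = A' u"
  shows "A = A'"
proof
  fix u
  have "\<forall>\<^sub>F N in sequentially.
      A (scaleX (inverse (2 ^ N)) u) = A' (scaleX (inverse (2 ^ N)) u)"
    using eq tendsto_scale_powers_of_half[of u] by (auto simp: filterlim_iff)
  then obtain N where "A (scaleX (inverse (2 ^ N)) u) = A' (scaleX (inverse (2 ^ N)) u)"
    using eventually_happens'[OF sequentially_bot] by blast
  then show "A u = A' u"
    using additive_rescale[OF A, of N u] additive_rescale[OF A', of N u] by simp
qed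

text \<open>The value at \<open>u\<close> is that of \<open>2 ^ N\<close> times \<open>D\<close> at
  \<open>u / 2 ^ N\<close> for large \<open>N\<close>. Additivity of \<open>D\<close> near 0 makes
  this sequence eventually constant, which replaces convergence, as \<open>Y\<close> carries no
  topology.\<close>

lemma locally_additive_extends:
  fixes D :: "'x \<Rightarrow> 'y"
  assumes "\<forall>\<^sub>F p in nhds 0 \<times>\<^sub>F nhds 0. D (fst p + snd p) = D (fst p) + D (snd p)"
  obtains A where "Modules.additive A" "\<forall>\<^sub>F u in nhds 0. D u = A u"
proof -
  obtain Q where Q: "eventually Q (nhds 0)"
    and add: "\<And>u v. Q u \<Longrightarrow> Q v \<Longrightarrow> D (u + v) = D u + D v"
    using assms by (auto simp: eventually_prod_same)
  define g where "g N u = scaleY (2 ^ N) (D (scaleX (inverse (2 ^ N)) u))" for N u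
  have g_Suc: "g (Suc N) u = g N u" if "Q (scaleX (inverse (2 ^ Suc N)) u)" for N u
    unfolding g_def scaleY_power2_Suc add[OF that that, symmetric] scaleX_half_add_half ..
  have Q_seq: "\<forall>\<^sub>F N in sequentially. Q (scaleX (inverse (2 ^ N)) u)" for u
    using Q tendsto_scale_powers_of_half[of u] by (auto simp: filterlim_iff)
  have "\<exists>a. \<forall>\<^sub>F N in sequentially. g N u = a" for u
  proof -
    obtain M where M: "\<And>N. N \<ge> M \<Longrightarrow> Q (scaleX (inverse (2 ^ N)) u)"
      using Q_seq[of u] by (auto simp: eventually_sequentially)
    have "g N u = g M u" if "N \<ge> M" for N
      using that by (induction N rule: nat_induct_at_least) (auto simp: g_Suc M simp del: power_Suc)
    then show ?thesis
      by (auto simp: eventually_sequentially)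
  qed
  then obtain A where A: "\<And>u. \<forall>\<^sub>F N in sequentially. g N u = A u"
    by metis
  have "A (u + v) = A u + A v" for u v
  proof -
    have "\<forall>\<^sub>F N in sequentially. A (u + v) = A u + A v"
      using A[of u] A[of v] A[of "u + v"] Q_seq[of u] Q_seq[of v]
    proof eventually_elim
      case (elim N)
      then show ?case
        by (metis (no_types) add g_def scale_right_distrib Y.scale_right_distrib)
    qed
    then show ?thesis
      by simp
  qed
  \<comment> \<open>On a balanced neighbourhood the sequence is constant already from
    \<open>N = 0\<close>, where its value is \<open>D u\<close>.\<close>
  moreover have "\<forall>\<^sub>F u in nhds 0. D u = A u"
    using eventually_nhds_0_scale_le_1[OF Q]
  proof eventually_elim
    case (elim u)
    have Qu: "Q (scaleX (inverse (2 ^ N)) u)" for N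
      using elim by (simp add: norm_inverse norm_power inverse_le_1_iff)
    have "g N u = D u" for N
      by (induction N) (simp_all add: g_Suc Qu del: power_Suc, simp add: g_def)
    then have "\<forall>\<^sub>F N in sequentially. D u = A u"
      using A[of u] by simp
    then show ?case
      by simp
  qed
  ultimately show thesis
    by (intro that[of A]) (simp_all add: Modules.additive_def)
qed

section \<open>From locally affine to affine on a connected open set\<close>

lemma locally_affine_on_connected:
  fixes f :: "'x \<Rightarrow> 'y"
  assumes "open K" "connected K"
    and local: "\<And>x. x \<in> K \<Longrightarrow> \<exists>A. Modules.additive A \<and> (\<forall>\<^sub>F y in nhds x. f y = f x + A (y - x))"
  obtains A b where "Modules.additive A" "\<And>x. x \<in> K \<Longrightarrow> f x = A x + b"
proof (cases "K = {}")
  case True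
  show ?thesis
    by (rule that[of "\<lambda>_. 0" 0]) (simp_all add: True Modules.additive_def)
next
  case False
  then obtain p where p: "p \<in> K" by blast
  obtain A where add: "\<And>x. x \<in> K \<Longrightarrow> Modules.additive (A x)"
    and A: "\<And>x. x \<in> K \<Longrightarrow> \<forall>\<^sub>F y in nhds x. f y = f x + A x (y - x)"
    using local by metis
  have A_local: "\<forall>\<^sub>F y in nhds x. A y = A x" if x: "x \<in> K" for x
  proof -
    have "\<forall>\<^sub>F y in nhds x. y \<in> K"
      using \<open>open K\<close> x by (rule eventually_nhds_in_open)
    \<comment> \<open>The expansion around \<open>x\<close> also holds near each \<open>y\<close>
      close to \<open>x\<close>, so that near \<open>y\<close> it can be compared with the expansion
      around \<open>y\<close> itself.\<close>
    moreover have "\<forall>\<^sub>F y in nhds x. \<forall>\<^sub>F z in nhds y. f z = f x + A x (z - x)"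
      using A[OF x] by (simp add: eventually_eventually)
    ultimately show ?thesis
      using A[OF x]
    proof eventually_elim
      case (elim y)
      have "\<forall>\<^sub>F z in nhds y. A y (z - y) = A x (z - y)"
        using elim(2) A[OF elim(1)]
      proof eventually_elim
        case (elim z)
        then have "A y (z - y) = A x (z - x) - A x (y - x)"
          using \<open>f y = f x + A x (y - x)\<close> by (simp add: algebra_simps)
        then show ?case
          by (simp add: additive.diff[OF add[OF x], symmetric])
      qed
      \<comment> \<open>Translation from \<open>y\<close> to 0, where \<open>additive_eqI\<close>
        compares additive maps.\<close>
      moreover have "((\<lambda>u. y + u) \<longlongrightarrow> y + 0) (nhds 0)"
        by (intro tendsto_add tendsto_const) (simp add: filterlim_ident)
      ultimately have "\<forall>\<^sub>F u in nhds 0. A y (y + u - y) = A x (y + u - y)"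
        by (auto simp: filterlim_iff)
      then show ?case
        by (intro additive_eqI add x elim(1)) simp
    qed
  qed
  have A_const: "A x = A p" if "x \<in> K" for x
    by (rule connected_local_const[OF \<open>connected K\<close> that p])
      (auto simp: eventually_at_filter intro: eventually_mono[OF A_local])
  have "f x - A p x = f p - A p p" if "x \<in> K" for x
  proof (rule connected_local_const[OF \<open>connected K\<close> that p], intro ballI)
    fix x assume x: "x \<in> K"
    have "\<forall>\<^sub>F y in nhds x. f x - A p x = f y - A p y"
      using A[OF x]
      by eventually_elim (simp add: A_const[OF x] additive.diff[OF add[OF p]])
    then show "\<forall>\<^sub>F y in at x within K. f x - A p x = f y - A p y"
      by (auto simp: eventually_at_filter elim: eventually_mono)
  qed
  then have "f x = A p x + (f p - A p p)" if "x \<in> K" for x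
    using that by (simp add: diff_eq_eq add.commute)
  then show ?thesis
    using that add[OF p] by blast
qed

section \<open>Local consequences of the functional equation\<close>

text \<open>The equation is evaluated at \<open>x + h\<close> in position \<open>i\<close>,
  \<open>x + k\<close> in position \<open>j\<close> and \<open>x\<close> elsewhere. Taking
  \<open>k = 0\<close> perturbs a single position.\<close>

lemma linear_functional_eq_perturb:
  fixes f :: "'x \<Rightarrow> 'y"
  assumes f: "linear_functional_eq scaleX scaleY n \<alpha> \<beta> K f"
    and ij: "i \<in> {1..n}" "j \<in> {1..n}" "i \<noteq> j"
    and K: "x \<in> K" "x + h \<in> K" "x + k \<in> K"
  shows "f ((\<Sum>l=1..n. scaleX (\<alpha> l) x) + scaleX (\<alpha> i) h + scaleX (\<alpha> j) k) =
    (\<Sum>l=1..n. scaleY (\<beta> l) (f x)) + scaleY (\<beta> i) (f (x + h) - f x) + scaleY (\<beta> j) (f (x + k) - f x)"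
proof -
  define z where "z l = (if l = i then x + h else if l = j then x + k else x)" for l
  have "scaleX (\<alpha> l) (z l) = scaleX (\<alpha> l) x + (if l = i then scaleX (\<alpha> i) h else 0)
      + (if l = j then scaleX (\<alpha> j) k else 0)" for l
    using ij(3) by (auto simp: z_def scale_right_distrib)
  then have 1: "(\<Sum>l=1..n. scaleX (\<alpha> l) (z l)) =
      (\<Sum>l=1..n. scaleX (\<alpha> l) x) + scaleX (\<alpha> i) h + scaleX (\<alpha> j) k"
    using ij by (simp add: sum.distrib)
  have "scaleY (\<beta> l) (f (z l)) = scaleY (\<beta> l) (f x)
      + (if l = i then scaleY (\<beta> i) (f (x + h) - f x) else 0)
      + (if l = j then scaleY (\<beta> j) (f (x + k) - f x) else 0)" for l
    using ij(3) by (auto simp: z_def Y.scale_right_diff_distrib)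
  then have 2: "(\<Sum>l=1..n. scaleY (\<beta> l) (f (z l))) = (\<Sum>l=1..n. scaleY (\<beta> l) (f x))
      + scaleY (\<beta> i) (f (x + h) - f x) + scaleY (\<beta> j) (f (x + k) - f x)"
    using ij by (simp add: sum.distrib)
  have "\<forall>l\<in>{1..n}. z l \<in> K"
    using K by (simp add: z_def)
  then have "f (\<Sum>l=1..n. scaleX (\<alpha> l) (z l)) = (\<Sum>l=1..n. scaleY (\<beta> l) (f (z l)))"
    using f by (simp add: linear_functional_eq_def)
  then show ?thesis
    unfolding 1 2 .
qed

lemma linear_functional_eq_locally_affine:
  fixes f :: "'x \<Rightarrow> 'y"
  assumes f: "linear_functional_eq scaleX scaleY n \<alpha> \<beta> K f"
    and ij: "i \<in> {1..n}" "j \<in> {1..n}" "i \<noteq> j"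
    and nz: "\<alpha> i \<noteq> 0" "\<alpha> j \<noteq> 0" "\<beta> i \<noteq> 0"
    and K: "open K" "x \<in> K"
  shows "\<exists>A. Modules.additive A \<and> (\<forall>\<^sub>F y in nhds x. f y = f x + A (y - x))"
proof -
  define D where "D h = f (x + h) - f x" for h
  define s where "s = (\<Sum>l=1..n. scaleX (\<alpha> l) x)"
  define t where "t = (\<Sum>l=1..n. scaleY (\<beta> l) (f x))"
  have pert: "f (s + scaleX (\<alpha> i) h + scaleX (\<alpha> j) k) = t + scaleY (\<beta> i) (D h) + scaleY (\<beta> j) (D k)"
    if "x + h \<in> K" "x + k \<in> K" for h k
    using linear_functional_eq_perturb[OF f ij K(2) that] by (simp add: D_def s_def t_def)
  have D0: "D 0 = 0"
    by (simp add: D_def)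
  \<comment> \<open>Displacing position \<open>j\<close> by \<open>c k\<close> changes the weighted
    sum exactly as displacing position \<open>i\<close> by \<open>k\<close> does.\<close>
  define c where "c = \<alpha> i / \<alpha> j"
  have c: "\<alpha> j * c = \<alpha> i"
    using nz(2) by (simp add: c_def)
  have D_add: "D (h + k) = D h + D k"
    if hk: "x + h \<in> K" "x + k \<in> K" "x + (h + k) \<in> K" "x + scaleX c k \<in> K" for h k
  proof -
    \<comment> \<open>The displacement pairs \<open>(h, c k)\<close> and \<open>(h + k, 0)\<close>
      give the same weighted sum; below, so do \<open>(0, c k)\<close> and \<open>(k, 0)\<close>.
      Eliminating the term with \<beta> j leaves a common factor \<beta> i, which cancels.\<close>
    have "scaleY (\<beta> i) (D (h + k)) = scaleY (\<beta> i) (D h) + scaleY (\<beta> j) (D (scaleX c k))"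
      using pert[OF hk(1,4)] pert[OF hk(3), of 0] K(2)
      by (simp add: c D0 scale_right_distrib add.assoc)
    moreover have "scaleY (\<beta> i) (D k) = scaleY (\<beta> j) (D (scaleX c k))"
      using pert[OF _ hk(4), of 0] pert[OF hk(2), of 0] K(2) by (simp add: c D0)
    ultimately have "scaleY (\<beta> i) (D (h + k)) = scaleY (\<beta> i) (D h + D k)"
      by (simp add: Y.scale_right_distrib)
    then show ?thesis
      using nz(3) by simp
  qed
  \<comment> \<open>Each of the four membership conditions in \<open>D_add\<close> has a
    displacement tending to 0, so all four hold for small \<open>h\<close> and
    \<open>k\<close>.\<close>
  have in_K: "\<forall>\<^sub>F p in nhds 0 \<times>\<^sub>F nhds 0. x + g p \<in> K"
    if "(g \<longlongrightarrow> 0) (nhds 0 \<times>\<^sub>F nhds 0)" for g :: "'x \<times> 'x \<Rightarrow> 'x"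
  proof -
    have "((\<lambda>p. x + g p) \<longlongrightarrow> x + 0) (nhds 0 \<times>\<^sub>F nhds 0)"
      by (intro tendsto_add tendsto_const that)
    then show ?thesis
      using K by (simp add: topological_tendstoD)
  qed
  have lims: "(fst \<longlongrightarrow> (0 :: 'x)) (nhds 0 \<times>\<^sub>F nhds (0 :: 'x))"
    "(snd \<longlongrightarrow> (0 :: 'x)) (nhds (0 :: 'x) \<times>\<^sub>F nhds 0)"
    by (rule filterlim_fst filterlim_snd)+
  have "\<forall>\<^sub>F p in nhds 0 \<times>\<^sub>F nhds 0. D (fst p + snd p) = D (fst p) + D (snd p)"
    using in_K[OF lims(1)] in_K[OF lims(2)] in_K[OF tendsto_add[OF lims, simplified]]
      in_K[OF tendsto_scale[OF tendsto_const lims(2), of c, simplified]]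
    by eventually_elim (rule D_add)
  then obtain A where A: "Modules.additive A" "\<forall>\<^sub>F u in nhds 0. D u = A u"
    by (rule locally_additive_extends)
  have "((\<lambda>y. y - x) \<longlongrightarrow> x - x) (nhds x)"
    by (intro tendsto_diff tendsto_const) (simp add: filterlim_ident)
  then have "\<forall>\<^sub>F y in nhds x. D (y - x) = A (y - x)"
    using A(2) by (auto simp: filterlim_iff)
  then have "\<forall>\<^sub>F y in nhds x. f y = f x + A (y - x)"
    by eventually_elim (simp add: D_def algebra_simps)
  with A(1) show ?thesis
    by blast
qed

section \<open>Homogeneity, uniqueness and the constant term\<close>

text \<open>Perturbing position \<open>i\<close> alone gives the identity for small vectors. Both
  sides are additive in the vector, so agreement near 0 spreads to the whole space.\<close>

lemma additive_part_homogeneous: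
  fixes f :: "'x \<Rightarrow> 'y"
  assumes f: "linear_functional_eq scaleX scaleY n \<alpha> \<beta> K f"
    and ij: "i \<in> {1..n}" "j \<in> {1..n}" "i \<noteq> j"
    and K: "open K" "p \<in> K" "weighted_sumset scaleX n \<alpha> K \<subseteq> K"
    and A: "Modules.additive A" and fA: "\<And>x. x \<in> K \<Longrightarrow> f x = A x + b"
  shows "A (scaleX (\<alpha> i) x) = scaleY (\<beta> i) (A x)"
proof -
  interpret A: Modules.additive A by (rule A)
  define s where "s = (\<Sum>l=1..n. scaleX (\<alpha> l) p)"
  \<comment> \<open>The perturbed sum must lie in \<open>K\<close> for \<open>f\<close> to be given
    by \<open>A\<close> and \<open>b\<close> there; this is where the inclusion of the weighted
    sumset enters.\<close>
  have sK: "s + scaleX (\<alpha> i) h \<in> K" if "p + h \<in> K" for h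
  proof -
    define z where "z l = (if l = i then p + h else p)" for l
    have "scaleX (\<alpha> l) (z l) = scaleX (\<alpha> l) p + (if l = i then scaleX (\<alpha> i) h else 0)" for l
      by (simp add: z_def scale_right_distrib)
    then have "(\<Sum>l=1..n. scaleX (\<alpha> l) (z l)) = s + scaleX (\<alpha> i) h"
      using ij(1) by (simp add: sum.distrib s_def)
    moreover have "\<forall>l\<in>{1..n}. z l \<in> K"
      using that K(2) by (simp add: z_def)
    ultimately have "s + scaleX (\<alpha> i) h \<in> weighted_sumset scaleX n \<alpha> K"
      unfolding weighted_sumset_def by (auto intro: exI[of _ z])
    then show ?thesis
      using K(3) by blast
  qed
  have hom: "A (scaleX (\<alpha> i) h) = scaleY (\<beta> i) (A h)" if h: "p + h \<in> K" for h
  proof -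
    have "f (s + scaleX (\<alpha> i) h) = f s + scaleY (\<beta> i) (f (p + h) - f p)"
      using linear_functional_eq_perturb[OF f ij K(2) h, of 0]
        linear_functional_eq_perturb[OF f ij K(2), of 0 0] K(2) by (simp add: s_def)
    then show ?thesis
      using sK[OF h] sK[of 0] h K(2) by (simp add: fA A.add)
  qed
  have "((\<lambda>h. p + h) \<longlongrightarrow> p + 0) (nhds 0)"
    by (intro tendsto_add tendsto_const) (simp add: filterlim_ident)
  then have "\<forall>\<^sub>F h in nhds 0. p + h \<in> K"
    using K by (simp add: topological_tendstoD)
  then have "\<forall>\<^sub>F h in nhds 0. A (scaleX (\<alpha> i) h) = scaleY (\<beta> i) (A h)"
    by eventually_elim (rule hom)
  then have "(\<lambda>h. A (scaleX (\<alpha> i) h)) = (\<lambda>h. scaleY (\<beta> i) (A h))"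
    by (intro additive_eqI)
      (simp_all add: Modules.additive_def scale_right_distrib Y.scale_right_distrib A.add)
  then show ?thesis
    by (rule fun_cong)
qed

text \<open>Differences of values at \<open>p + h\<close> and \<open>p\<close> cancel the constants,
  so the additive parts agree near 0 and hence everywhere; then \<open>p\<close> itself determines
  the constant.\<close>

lemma affine_on_open_unique:
  fixes A A' :: "'x \<Rightarrow> 'y"
  assumes K: "open K" "p \<in> K"
    and A: "Modules.additive A" and A': "Modules.additive A'"
    and eq: "\<And>x. x \<in> K \<Longrightarrow> A x + b = A' x + b'"
  shows "A = A' \<and> b = b'"
proof -
  have "((\<lambda>h. p + h) \<longlongrightarrow> p + 0) (nhds 0)"
    by (intro tendsto_add tendsto_const) (simp add: filterlim_ident)
  then have "\<forall>\<^sub>F h in nhds 0. p + h \<in> K"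
    using K by (simp add: topological_tendstoD)
  then have "\<forall>\<^sub>F h in nhds 0. A h = A' h"
  proof eventually_elim
    case (elim h)
    have "A h = (A (p + h) + b) - (A p + b)"
      by (simp add: additive.add[OF A])
    also have "\<dots> = (A' (p + h) + b') - (A' p + b')"
      by (simp only: eq[OF elim] eq[OF K(2)])
    also have "\<dots> = A' h"
      by (simp add: additive.add[OF A'])
    finally show ?case .
  qed
  with A A' have "A = A'"
    by (rule additive_eqI)
  with eq[OF K(2)] show ?thesis
    by simp
qed

text \<open>After substitution the additive parts cancel by homogeneity, and what remains is a
  condition on \<open>b\<close> that does not involve the points chosen. Since \<open>K\<close> is
  non-empty, the equation has an instance, which makes the condition necessary as well as
  sufficient.\<close>

lemma linear_functional_eq_affine_iff:
  fixes f :: "'x \<Rightarrow> 'y"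
  assumes K: "K \<noteq> {}" "weighted_sumset scaleX n \<alpha> K \<subseteq> K"
    and A: "Modules.additive A"
    and hom: "\<forall>x. \<forall>i\<in>{1..n}. A (scaleX (\<alpha> i) x) = scaleY (\<beta> i) (A x)"
    and fA: "\<forall>x\<in>K. f x = A x + b"
  shows "linear_functional_eq scaleX scaleY n \<alpha> \<beta> K f \<longleftrightarrow> ((\<Sum>i=1..n. \<beta> i) \<noteq> 1 \<longrightarrow> b = 0)"
proof -
  interpret A: Modules.additive A by (rule A)
  have *: "f (\<Sum>i=1..n. scaleX (\<alpha> i) (x i)) = (\<Sum>i=1..n. scaleY (\<beta> i) (f (x i))) \<longleftrightarrow>
      scaleY ((\<Sum>i=1..n. \<beta> i) - 1) b = 0" if x: "\<forall>i\<in>{1..n}. x i \<in> K" for x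
  proof -
    have "(\<Sum>i=1..n. scaleX (\<alpha> i) (x i)) \<in> K"
      using K(2) x by (auto simp: weighted_sumset_def)
    then have "f (\<Sum>i=1..n. scaleX (\<alpha> i) (x i)) = (\<Sum>i=1..n. scaleY (\<beta> i) (A (x i))) + b"
      using fA hom by (simp add: A.sum)
    moreover have "(\<Sum>i=1..n. scaleY (\<beta> i) (f (x i))) =
        (\<Sum>i=1..n. scaleY (\<beta> i) (A (x i))) + scaleY (\<Sum>i=1..n. \<beta> i) b"
      using fA x by (simp add: Y.scale_right_distrib sum.distrib Y.scale_sum_left)
    ultimately show ?thesis
      by (auto simp: Y.scale_left_diff_distrib)
  qed
  from K(1) obtain p where "p \<in> K"
    by blast
  then have "\<exists>x. \<forall>i\<in>{1..n}. x i \<in> K"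
    by (intro exI[of _ "\<lambda>_. p"]) simp
  then have "linear_functional_eq scaleX scaleY n \<alpha> \<beta> K f \<longleftrightarrow> scaleY ((\<Sum>i=1..n. \<beta> i) - 1) b = 0"
    using * unfolding linear_functional_eq_def by blast
  then show ?thesis
    by auto
qed

lemma linear_functional_eq_imp_affine:
  fixes f :: "'x \<Rightarrow> 'y"
  assumes f: "linear_functional_eq scaleX scaleY n \<alpha> \<beta> K f" and n: "n \<ge> 2"
    and \<alpha>: "\<forall>i\<in>{1..n}. \<alpha> i \<noteq> 0" and \<beta>: "\<forall>i\<in>{1..n}. \<beta> i \<noteq> 0"
    and K: "K \<noteq> {}" "open K" "connected K" "weighted_sumset scaleX n \<alpha> K \<subseteq> K"
  obtains A b where "Modules.additive A"
    and "\<forall>x. \<forall>i\<in>{1..n}. A (scaleX (\<alpha> i) x) = scaleY (\<beta> i) (A x)"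
    and "\<forall>x\<in>K. f x = A x + b"
proof -
  \<comment> \<open>The bound on \<open>n\<close> supplies two distinct positions to perturb, and
    thereby a partner for every index \<open>i\<close>.\<close>
  have 12: "1 \<in> {1..n}" "2 \<in> {1..n}" "1 \<noteq> (2 :: nat)"
    using n by auto
  have "\<exists>A. Modules.additive A \<and> (\<forall>\<^sub>F y in nhds x. f y = f x + A (y - x))" if "x \<in> K" for x
    by (rule linear_functional_eq_locally_affine[OF f 12 _ _ _ K(2) that]) (use \<alpha> \<beta> 12 in blast)+
  from locally_affine_on_connected[OF K(2,3) this]
  obtain A b where A: "Modules.additive A" "\<And>x. x \<in> K \<Longrightarrow> f x = A x + b"
    by blast
  obtain p where p: "p \<in> K"
    using K(1) by blast
  have "A (scaleX (\<alpha> i) x) = scaleY (\<beta> i) (A x)" if i: "i \<in> {1..n}" for i x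
  proof -
    obtain j where "j \<in> {1..n}" "i \<noteq> j"
      using 12 by metis
    with i show ?thesis
      by (rule additive_part_homogeneous[OF f _ _ _ K(2) p K(4) A])
  qed
  with A show thesis
    using that by blast
qed

end

text \<open>That \<open>b\<close> can be arbitrary when the \<beta> i sum to 1 is contained in the
  converse part, whose condition on \<open>b\<close> is then vacuous.\<close>

theorem theorem1p1:
  fixes scaleX :: "'k::real_or_complex \<Rightarrow> 'x::topological_ab_group_add \<Rightarrow> 'x"
    and scaleY :: "'f::field_char_0 \<Rightarrow> 'y::ab_group_add \<Rightarrow> 'y"
    and n :: nat and \<alpha> :: "nat \<Rightarrow> 'k" and \<beta> :: "nat \<Rightarrow> 'f" and K :: "'x set"
  assumes "topological_vector_space scaleX"
    and "vector_space scaleY"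
    and "n \<ge> 2"
    and "\<forall>i\<in>{1..n}. \<alpha> i \<noteq> 0"
    and "\<forall>i\<in>{1..n}. \<beta> i \<noteq> 0"
    and "K \<noteq> {}" and "open K" and "connected K"
    and "weighted_sumset scaleX n \<alpha> K \<subseteq> K"
  shows
    "(\<forall>f :: 'x \<Rightarrow> 'y. linear_functional_eq scaleX scaleY n \<alpha> \<beta> K f \<longrightarrow>
        (\<exists>!(A, b). Modules.additive A \<and>
           (\<forall>x. \<forall>i\<in>{1..n}. A (scaleX (\<alpha> i) x) = scaleY (\<beta> i) (A x)) \<and>
           (\<forall>x\<in>K. f x = A x + b)) \<and>
        (\<forall>A b. Modules.additive A \<and>
           (\<forall>x. \<forall>i\<in>{1..n}. A (scaleX (\<alpha> i) x) = scaleY (\<beta> i) (A x)) \<and>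
           (\<forall>x\<in>K. f x = A x + b) \<longrightarrow>
           (\<Sum>i=1..n. \<beta> i) \<noteq> 1 \<longrightarrow> b = 0)) \<and>
     (\<forall>(A :: 'x \<Rightarrow> 'y) b f. Modules.additive A \<and>
        (\<forall>x. \<forall>i\<in>{1..n}. A (scaleX (\<alpha> i) x) = scaleY (\<beta> i) (A x)) \<and>
        (\<forall>x\<in>K. f x = A x + b) \<and>
        ((\<Sum>i=1..n. \<beta> i) \<noteq> 1 \<longrightarrow> b = 0) \<longrightarrow>
        linear_functional_eq scaleX scaleY n \<alpha> \<beta> K f)"
proof -
  interpret topological_vector_space scaleX by fact
  interpret Y: vector_space scaleY by fact
  interpret tvs_vector_space_pair scaleX scaleY ..
  obtain p where p: "p \<in> K"
    using \<open>K \<noteq> {}\<close> by blast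
  let ?rep = "\<lambda>f (A :: 'x \<Rightarrow> 'y) b. Modules.additive A \<and>
    (\<forall>x. \<forall>i\<in>{1..n}. A (scaleX (\<alpha> i) x) = scaleY (\<beta> i) (A x)) \<and> (\<forall>x\<in>K. f x = A x + b)"
  have iff: "linear_functional_eq scaleX scaleY n \<alpha> \<beta> K f \<longleftrightarrow> ((\<Sum>i=1..n. \<beta> i) \<noteq> 1 \<longrightarrow> b = 0)"
    if "?rep f A b" for f A b
    using that linear_functional_eq_affine_iff[OF \<open>K \<noteq> {}\<close> assms(9)] by blast
  have unique: "A = A' \<and> b = b'" if "?rep f A b" "?rep f A' b'" for f A b A' b'
    using that by (intro affine_on_open_unique[OF \<open>open K\<close> p]) auto
  have "\<exists>!(A, b). ?rep f A b" if f: "linear_functional_eq scaleX scaleY n \<alpha> \<beta> K f" for f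
  proof -
    obtain A b where A: "?rep f A b"
      using linear_functional_eq_imp_affine[OF f assms(3-9)] by metis
    show ?thesis
    proof (rule ex1I[of _ "(A, b)"])
      show "case (A, b) of (A, b) \<Rightarrow> ?rep f A b"
        using A by simp
    next
      fix q assume "case q of (A, b) \<Rightarrow> ?rep f A b"
      then show "q = (A, b)"
        using unique[OF A] by (cases q) auto
    qed
  qed
  \<comment> \<open>Read from left to right, \<open>iff\<close> forces \<open>b = 0\<close> when the
    sum is not 1; from right to left it is the converse part.\<close>
  then show ?thesis
    using iff by blast
qed

end
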